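(* Let $b\in\mathbb{Z}$, $b\neq 0$, let $k\ge 0$ be an integer and put $r=k+2$. Then $$Z_k^{\mathrm{SU}(2)}(M^b)=Z_k^{\mathrm{SU}(2)}(\tilde M^b)=\exp\left(\frac{\pi i b}{2r}\right)\left(\sqrt{\frac{r}{2|b|}}\,\exp(-\pi i\,\mathrm{sgn}(b)/4)\sum_{n=0}^{|b|-1}\exp(2\pi i r n^2/b)-\frac12-\frac{\exp(-\pi i r b/2)}{2}\right).$$
   Context: Let $\Sigma=S^1\times S^1$, $\mu=\{1\}\times S^1$, let $t_\mu=\begin{pmatrix}1&-1\\0&1\end{pmatrix}\in \mathrm{SL}(2,\mathbb{Z})\cong\mathrm{MCG}(\Sigma)$ be the left Dehn twist about $\mu$, and let $\varpi=-\mathrm{id}\in\mathrm{SL}(2,\mathbb{Z})$ be the elliptic involution. For a homeomorphism $\phi$ of $\Sigma$, the mapping torus is $T_\phi=(\Sigma\times[0,1])/(x,0)\sim(\phi(x),1)$. Put $M^b=T_{t_\mu^b}$ and $\tilde M^b=T_{\varpi t_\mu^b}$. $Z_k^{\mathrm{SU}(2)}$ is the level $k$ Witten--Reshetikhin--Turaev $\mathrm{SU}(2)$-invariant, in the normalization of Blanchet's Homflypt skein TQFT with $a=\exp(-2\pi i/(4r))$, $s=a^{-2}$, $v=s^{-2}$, $r=k+2$. For mapping tori, $Z_k(T_f)=\mathrm{tr}\,\rho_k(f)$, where $\rho_k$ is the (projective) quantum representation of $\mathrm{MCG}(\Sigma)$ on the space $V_k(\Sigma)$ with basis $\hat y_n$,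 $0\le n\le k$. In this basis $\rho_k(t_\mu)$ is diagonal with entries $a^{n^2+2n}$ and $\rho_k(\varpi)$ is the identity. The dependence on a 2-framing (a scalar of modulus one, the framing anomaly) is fixed by this explicit normalization. *)

theory Defs
  imports "Jordan_Normal_Form.Gauss_Jordan_Elimination" "HOL-Analysis.Analysis"
begin

no_notation vec_index (infixl "$" 100)

section \<open>The torus, its mapping classes and their mapping tori\<close>

definition torus :: "(complex \<times> complex) set" where
  "torus = sphere 0 1 \<times> sphere 0 1"

text \<open>
  A matrix acts on \<open>H\<^sub>1(torus)\<close> in the ordered basis \<open>\<mu> = {1} \<times> S\<^sup>1\<close>, \<open>\<lambda> = S\<^sup>1 \<times> {1}\<close>; hence the
  first coordinate of the integer vector belongs to the \<^emph>\<open>second\<close> factor of the torus. For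
  the matrix of \<open>t\<^sub>\<mu>\<close> below this is \<open>(z, w) \<mapsto> (z, w / z)\<close>, which fixes \<open>\<mu>\<close> pointwise.
\<close>

definition torus_homeo :: "int^2^2 \<Rightarrow> complex \<times> complex \<Rightarrow> complex \<times> complex" where
  "torus_homeo A = (\<lambda>(z, w). (w powi (A$2$1) * z powi (A$2$2), w powi (A$1$1) * z powi (A$1$2)))"

definition mapping_torus_rel ::
  "(complex \<times> complex \<Rightarrow> complex \<times> complex) \<Rightarrow>
    (((complex \<times> complex) \<times> real) \<times> ((complex \<times> complex) \<times> real)) set" where
  "mapping_torus_rel \<phi> =
    (let E = {((x, 0), (\<phi> x, 1)) | x. x \<in> torus}
     in Restr ((E \<union> E\<inverse>)\<^sup>*) (torus \<times> {0..1}))"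

text \<open>The space \<open>T\<^sub>\<phi>\<close>, with the quotient topology; its points are the equivalence classes.\<close>

definition mapping_torus ::
  "(complex \<times> complex \<Rightarrow> complex \<times> complex) \<Rightarrow> ((complex \<times> complex) \<times> real) set topology" where
  "mapping_torus \<phi> = topology (\<lambda>U. U \<subseteq> (torus \<times> {0..1}) // mapping_torus_rel \<phi> \<and>
     openin (top_of_set (torus \<times> {0..1})) (\<Union>U))"

lemma equiv_mapping_torus_rel: "equiv (torus \<times> {0..1}) (mapping_torus_rel \<phi>)"
  unfolding mapping_torus_rel_def Let_def
  apply (rule equivI)
  subgoal by auto
  subgoal by (auto simp: refl_on_def)
  subgoal
  proof -
    let ?E = "{((x, 0::real), (\<phi> x, 1::real)) | x. x \<in> torus}"
    have "sym ((?E \<union> ?E\<inverse>)\<^sup>*)" by (rule sym_rtrancl[OF sym_Un_converse])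
    then show ?thesis by (auto simp: sym_def)
  qed
  subgoal by (auto simp: trans_def)
  done

lemma openin_mapping_torus:
  "openin (mapping_torus \<phi>) U \<longleftrightarrow> U \<subseteq> (torus \<times> {0..1}) // mapping_torus_rel \<phi> \<and>
     openin (top_of_set (torus \<times> {0..1})) (\<Union>U)"
proof -
  let ?Q = "(torus \<times> {0..1::real}) // mapping_torus_rel \<phi>"
  have "istopology (\<lambda>U. U \<subseteq> ?Q \<and> openin (top_of_set (torus \<times> {0..1})) (\<Union>U))"
    unfolding istopology_def
  proof (intro conjI allI impI)
    fix S T
    assume S: "S \<subseteq> ?Q \<and> openin (top_of_set (torus \<times> {0..1})) (\<Union>S)"
      and T: "T \<subseteq> ?Q \<and> openin (top_of_set (torus \<times> {0..1})) (\<Union>T)"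
    show "S \<inter> T \<subseteq> ?Q" using S by blast
    have "\<Union>(S \<inter> T) = \<Union>S \<inter> \<Union>T"
    proof
      show "\<Union>S \<inter> \<Union>T \<subseteq> \<Union>(S \<inter> T)"
      proof
        fix x assume "x \<in> \<Union>S \<inter> \<Union>T"
        then obtain X Y where "X \<in> S" "Y \<in> T" "x \<in> X" "x \<in> Y" by blast
        moreover from this have "X = Y"
          using quotient_disj[OF equiv_mapping_torus_rel, of X \<phi> Y] S T by blast
        ultimately show "x \<in> \<Union>(S \<inter> T)" by blast
      qed
    qed blast
    then show "openin (top_of_set (torus \<times> {0..1})) (\<Union>(S \<inter> T))"
      using S T by auto
  next
    fix \<K>
    assume K: "\<forall>K\<in>\<K>. K \<subseteq> ?Q \<and> openin (top_of_set (torus \<times> {0..1})) (\<Union>K)"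
    then show "\<Union>\<K> \<subseteq> ?Q" by blast
    have "openin (top_of_set (torus \<times> {0..1})) (\<Union>K\<in>\<K>. \<Union>K)"
      by (rule openin_Union) (use K in auto)
    moreover have "(\<Union>K\<in>\<K>. \<Union>K) = \<Union>(\<Union>\<K>)" by blast
    ultimately show "openin (top_of_set (torus \<times> {0..1})) (\<Union>(\<Union>\<K>))" by simp
  qed
  then show ?thesis by (simp add: mapping_torus_def)
qed

text \<open>
  The mapping class group of the torus is \<open>SL(2,\<int>)\<close>. The quantum representation is only
  projective, so an operator is attached to an expression of a mapping class in the generators
  (equivalently, to a lift of the class to a central extension) and not to the class alone; such
  an expression is what fixes the 2-framing of the mapping torus. A word is a list of
  generators, each with a flag telling whether it is inverted; it is read as a product from
  left to right, so that the rightmost letter acts first.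
\<close>

datatype mcg_gen = Twist | Elliptic | Switch

type_synonym mcg_word = "(mcg_gen \<times> bool) list"

fun gen_class :: "mcg_gen \<Rightarrow> int^2^2" where
  "gen_class Twist = vector [vector [1, -1], vector [0, 1]]"
| "gen_class Elliptic = - mat 1"
| "gen_class Switch = vector [vector [0, -1], vector [1, 0]]"

fun word_class :: "mcg_word \<Rightarrow> int^2^2" where
  "word_class [] = mat 1"
| "word_class ((g, inverted) # w) =
    (if inverted then matrix_inv (gen_class g) else gen_class g) ** word_class w"

lemma det_gen_class: "det (gen_class g) = 1"
  by (cases g) (simp_all add: det_2 mat_def)

lemma invertible_gen_class: "\<exists>B. gen_class g ** B = mat 1 \<and> B ** gen_class g = mat 1"
proof -
  let ?A = "gen_class g"
  let ?B = "vector [vector [?A$2$2, - ?A$1$2], vector [- ?A$2$1, ?A$1$1]] :: int^2^2"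
  have "?A$1$1 * ?A$2$2 - ?A$1$2 * ?A$2$1 = 1"
    using det_gen_class[of g] by (simp add: det_2)
  then have "?A ** ?B = mat 1 \<and> ?B ** ?A = mat 1"
    by (simp add: vec_eq_iff matrix_matrix_mult_def mat_def sum_2 forall_2 algebra_simps)
  then show ?thesis by blast
qed

lemma det_word_class: "det (word_class w) = 1"
proof (induction w rule: word_class.induct)
  case (2 g inverted w)
  have "gen_class g ** matrix_inv (gen_class g) = mat 1"
    using someI_ex[OF invertible_gen_class[of g]] by (simp add: matrix_inv_def)
  then have "det (matrix_inv (gen_class g)) = 1"
    by (metis det_I det_mul det_gen_class mult_1)
  with 2 show ?case by (simp add: det_mul det_gen_class)
qed simp

section \<open>The level \<open>k\<close> quantum representation\<close>

text \<open>The space \<open>V\<^sub>k\<close> of the torus is \<open>\<complex>\<^bsup>k+1\<^esup>\<close>, with basis \<open>y\<^sub>0, \<dots>, y\<^sub>k\<close>.\<close>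

definition skein_a :: "nat \<Rightarrow> complex" where
  "skein_a k = exp (- (2 * pi * \<i>) / (4 * of_nat (k + 2)))"

text \<open>
  The \<open>Switch\<close> matrix is the unitary normalisation of the Hopf link matrix \<open>[(i+1)(j+1)]\<close>, with
  quantum integers formed with \<open>s = a\<^sup>-\<^sup>2\<close>; it squares to the identity.
\<close>

fun gen_op :: "nat \<Rightarrow> mcg_gen \<Rightarrow> complex Matrix.mat" where
  "gen_op k Twist =
    Matrix.mat (k + 1) (k + 1) (\<lambda>(i, j). if i = j then skein_a k ^ (i\<^sup>2 + 2 * i) else 0)"
| "gen_op k Elliptic = 1\<^sub>m (k + 1)"
| "gen_op k Switch =
    Matrix.mat (k + 1) (k + 1) (\<lambda>(i, j).
      complex_of_real (sqrt (2 / real (k + 2)) *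
        sin (pi * real (i + 1) * real (j + 1) / real (k + 2))))"

fun quantum_rep :: "nat \<Rightarrow> mcg_word \<Rightarrow> complex Matrix.mat" where
  "quantum_rep k [] = 1\<^sub>m (k + 1)"
| "quantum_rep k ((g, inverted) # w) =
    (if inverted then the (mat_inverse (gen_op k g)) else gen_op k g) * quantum_rep k w"

definition mat_trace :: "complex Matrix.mat \<Rightarrow> complex" where
  "mat_trace A = (\<Sum>i<dim_row A. A $$ (i, i))"

section \<open>The invariant of mapping tori\<close>

text \<open>
  A mapping torus together with its 2-framing: the space, and the word for the monodromy that
  determines the framing.
\<close>

type_synonym framed_mapping_torus = "((complex \<times> complex) \<times> real) set topology \<times> mcg_word"

definition framed_mapping_torus :: "mcg_word \<Rightarrow> framed_mapping_torus" where
  "framed_mapping_torus w = (mapping_torus (torus_homeo (word_class w)), w)"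

text \<open>
  On a mapping torus the TQFT gluing rule expresses the invariant as the trace of the operator of
  the monodromy. The full skein construction for arbitrary closed 3-manifolds is not developed
  here, so the invariant is defined on mapping tori, by this trace; the first component of
  the pair is determined by the word.
\<close>

definition Z_SU2 :: "nat \<Rightarrow> framed_mapping_torus \<Rightarrow> complex" where
  "Z_SU2 k = (\<lambda>(X, w). mat_trace (quantum_rep k w))"

definition twist_power :: "int \<Rightarrow> mcg_word" where
  "twist_power b = replicate (nat \<bar>b\<bar>) (Twist, b < 0)"

definition M :: "int \<Rightarrow> framed_mapping_torus" where
  "M b = framed_mapping_torus (twist_power b)"

definition M_tilde :: "int \<Rightarrow> framed_mapping_torus" where
  "M_tilde b = framed_mapping_torus ((Elliptic, False) # twist_power b)"

lemma word_class_twist_power: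
  "word_class (twist_power b) = vector [vector [1, - b], vector [0, 1]]"
proof -
  define U :: "int \<Rightarrow> int^2^2" where "U c = vector [vector [1, c], vector [0, 1]]" for c
  have U_mult: "U c ** U d = U (c + d)" for c d
    by (simp add: U_def vec_eq_iff matrix_matrix_mult_def sum_2 forall_2)
  have U_0: "U 0 = mat 1"
    by (simp add: U_def vec_eq_iff mat_def forall_2)
  have twist: "gen_class Twist = U (- 1)"
    by (simp add: U_def)
  have "matrix_inv (U (- 1)) ** U (- 1) = mat 1"
    using someI_ex[OF invertible_gen_class[of Twist]] unfolding twist by (simp add: matrix_inv_def)
  then have "matrix_inv (U (- 1)) ** (U (- 1) ** U 1) = U 1"
    unfolding matrix_mul_assoc by simp
  then have inv: "matrix_inv (gen_class Twist) = U 1"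
    unfolding U_mult twist by (simp add: U_0)
  have "word_class (replicate n (Twist, False)) = U (- int n)" for n
    by (induction n) (simp_all add: U_0 twist U_mult del: gen_class.simps)
  moreover have "word_class (replicate n (Twist, True)) = U (int n)" for n
    by (induction n) (simp_all add: U_0 inv U_mult del: gen_class.simps)
  ultimately have "word_class (twist_power b) = U (- b)"
    by (cases "b < 0") (simp_all add: twist_power_def)
  then show ?thesis by (simp add: U_def)
qed

lemma torus_homeo_mult:
  assumes "x \<in> torus"
  shows "torus_homeo (A ** B) x = torus_homeo A (torus_homeo B x)"
proof -
  obtain z w where x: "x = (z, w)" by (cases x)
  have z: "z \<noteq> 0" and w: "w \<noteq> 0" using assms by (auto simp: x torus_def)
  have *: "w powi (p * b + q * d) * z powi (p * b' + q * d') =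
      (w powi b * z powi b') powi p * (w powi d * z powi d') powi q" for p q b b' d d' :: int
    by (simp add: power_int_add z w power_int_mult_distrib mult.commute[of p] mult.commute[of q]
        power_int_mult)
  show ?thesis
    unfolding x torus_homeo_def matrix_matrix_mult_def
    by (simp add: sum_2 *)
qed

end

theory Submission
  imports Defs "HOL-Complex_Analysis.Residue_Theorem" "HOL-Probability.Distributions"
    "HOL-Real_Asymp.Real_Asymp"
begin

text \<open>
  The twist is diagonal with entries \<open>a\<^bsup>j\<^sup>2 + 2j\<^esup>\<close>, and \<open>j\<^sup>2 + 2j = n\<^sup>2 - 1\<close> for \<open>n = j + 1\<close>. The trace of its
  \<open>b\<close>-th power is therefore \<open>exp (\<pi> \<i> b / 2r)\<close> times the sum over \<open>1 \<le> n < r\<close> of \<open>exp (- \<pi> \<i> b n\<^sup>2 / 2r)\<close>.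
  This summand is \<open>2r\<close>-periodic and even in \<open>n\<close>, so the sum is half of a complete quadratic
  Gauss sum modulo \<open>2r\<close> from which the two fixed points \<open>n = 0\<close> and \<open>n = r\<close> of \<open>n \<mapsto> - n\<close> have been
  removed; they give the terms \<open>- 1/2\<close> and \<open>- exp (- \<pi> \<i> r b / 2) / 2\<close>
  (\<open>sum_symmetric_lessThan_double\<close>, \<open>half_gauss_sum\<close>).

  What remains is the reciprocity law of Landsberg and Schaar, \<open>gauss_sum_reciprocity\<close>, which
  exchanges a Gauss sum of length \<open>c\<close> for one of length \<open>a\<close>. Put \<open>\<beta> = a / c\<close> and
  \<open>E z = exp (\<pi> \<i> \<beta> z\<^sup>2)\<close>. The function \<open>g z = E z / (exp (2 \<pi> \<i> z) - 1)\<close> has residue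
  \<open>E n / (2 \<pi> \<i>)\<close> at each integer \<open>n\<close>. On lines of direction \<open>1 + \<i>\<close> the factor \<open>E\<close> decays like a
  Gaussian, so the integral of \<open>g\<close> over the line through \<open>c - 1/2\<close> minus that over the line
  through \<open>- 1/2\<close> is the Gauss sum of length \<open>c\<close>. On the other hand \<open>a c\<close> is even, hence
  \<open>g (z + c) - g z = E z (1 + w + \<dots> + w\<^bsup>a - 1\<^esup>)\<close> with \<open>w = exp (2 \<pi> \<i> z)\<close>. Completing the square turns
  the \<open>k\<close>-th term into \<open>exp (- \<pi> \<i> c k\<^sup>2 / a)\<close> times a translate of \<open>E\<close>, and all real translates of \<open>E\<close>
  have the same integral \<open>(1 + \<i>) / sqrt (2 \<beta>)\<close> along the line.
\<close>

section \<open>Integrals along lines of direction 1 + i\<close>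

definition quadratic_phase :: "real \<Rightarrow> complex \<Rightarrow> complex" where
  "quadratic_phase \<beta> z = exp (\<i> * pi * of_real \<beta> * z\<^sup>2)"

text \<open>
  The point with parameter \<open>s\<close> on the line through the real point \<open>x\<close> along which the quadratic
  phase decays. The direction \<open>1 + \<i>\<close> is left unnormalised so that the parameter is the imaginary part.
\<close>

definition diag :: "real \<Rightarrow> real \<Rightarrow> complex" where
  "diag x s = of_real x + of_real s * (1 + \<i>)"

definition diag_path :: "real \<Rightarrow> real \<Rightarrow> real \<Rightarrow> complex" where
  "diag_path x T = linepath (diag x (- T)) (diag x T)"

definition parallelogram :: "real \<Rightarrow> real \<Rightarrow> real \<Rightarrow> real \<Rightarrow> complex" where
  "parallelogram p q T =
     linepath (diag p (- T)) (diag q (- T)) +++ diag_path q T +++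
     linepath (diag q T) (diag p T) +++ linepath (diag p T) (diag p (- T))"

lemma Re_diag [simp]: "Re (diag x s) = x + s" and Im_diag [simp]: "Im (diag x s) = s"
  by (simp_all add: diag_def)

lemma norm_quadratic_phase_diag:
  "norm (quadratic_phase \<beta> (diag x s)) = exp (- (2 * pi * \<beta> * (s\<^sup>2 + x * s)))"
proof -
  have "Im ((diag x s)\<^sup>2) = 2 * (s\<^sup>2 + x * s)"
    by (simp add: power2_eq_square algebra_simps)
  then show ?thesis
    by (simp add: quadratic_phase_def)
qed

lemma holomorphic_on_quadratic_phase [holomorphic_intros]: "quadratic_phase \<beta> holomorphic_on A"
  unfolding quadratic_phase_def by (intro holomorphic_intros)

lemma closed_segment_diag_horizontal:
  assumes "z \<in> closed_segment (diag p s) (diag q s)"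
  obtains x where "x \<in> closed_segment p q" "z = diag x s"
proof -
  from assms obtain u where u: "0 \<le> u" "u \<le> 1" "z = (1 - u) *\<^sub>R diag p s + u *\<^sub>R diag q s"
    by (auto simp: in_segment)
  show thesis
  proof
    show "(1 - u) *\<^sub>R p + u *\<^sub>R q \<in> closed_segment p q" using u by (auto simp: in_segment)
    show "z = diag ((1 - u) *\<^sub>R p + u *\<^sub>R q) s"
      using u by (simp add: complex_eq_iff algebra_simps)
  qed
qed

lemma Im_closed_segment_diag_horizontal:
  "z \<in> closed_segment (diag p s) (diag q s) \<Longrightarrow> Im z = s"
  by (erule closed_segment_diag_horizontal) simp

lemma closed_segment_diag_slanted:
  assumes "z \<in> closed_segment (diag x s) (diag x t)"
  shows "Re z - Im z = x"
proof -
  from assms obtain u where "z = (1 - u) *\<^sub>R diag x s + u *\<^sub>R diag x t"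
    by (auto simp: in_segment)
  then have "z = diag x ((1 - u) * s + u * t)"
    by (simp add: complex_eq_iff algebra_simps)
  then show ?thesis by simp
qed

lemma path_image_parallelogram:
  "path_image (parallelogram p q T) =
     closed_segment (diag p (- T)) (diag q (- T)) \<union> closed_segment (diag q (- T)) (diag q T) \<union>
     closed_segment (diag q T) (diag p T) \<union> closed_segment (diag p T) (diag p (- T))"
  by (simp add: parallelogram_def diag_path_def path_image_join Un_assoc)

lemma valid_path_parallelogram [simp]: "valid_path (parallelogram p q T)"
  and pathfinish_parallelogram [simp]: "pathfinish (parallelogram p q T) = diag p (- T)"
  and pathstart_parallelogram [simp]: "pathstart (parallelogram p q T) = diag p (- T)"
  by (simp_all add: parallelogram_def diag_path_def)

text \<open>The decomposition behind every contour shift below: two slanted and two horizontal sides.\<close>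

lemma contour_integral_parallelogram:
  assumes "continuous_on (path_image (parallelogram p q T)) f"
  shows "contour_integral (parallelogram p q T) f =
    contour_integral (diag_path q T) f - contour_integral (diag_path p T) f
    + contour_integral (linepath (diag p (- T)) (diag q (- T))) f
    - contour_integral (linepath (diag p T) (diag q T)) f"
proof -
  have c: "continuous_on (closed_segment (diag p (- T)) (diag q (- T))) f"
    "continuous_on (closed_segment (diag q (- T)) (diag q T)) f"
    "continuous_on (closed_segment (diag q T) (diag p T)) f"
    "continuous_on (closed_segment (diag p T) (diag p (- T))) f"
    by (rule continuous_on_subset[OF assms]; auto simp: path_image_parallelogram)+
  then show ?thesis
    using contour_integral_reverse_linepath[OF c(3)] contour_integral_reverse_linepath[OF c(4)]
    by (simp add: parallelogram_def diag_path_def contour_integrable_continuous_linepath)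
qed

text \<open>
  The horizontal sides do not contribute in the limit: \<open>f\<close> is dominated there by the quadratic
  phase, whose norm at height \<open>\<plusminus> T\<close> is at most \<open>exp (- 2 \<pi> \<beta> (T\<^sup>2 - X T))\<close>, where \<open>X\<close> bounds \<open>\<bar>x\<bar>\<close>
  for \<open>x\<close> between \<open>p\<close> and \<open>q\<close>. The lemma is used both
  for the phase itself, with \<open>c = 0\<close>, and for a kernel with poles, where \<open>c\<close> comes from the residues.
\<close>

lemma diag_path_difference_tendsto:
  fixes f :: "complex \<Rightarrow> complex"
  assumes \<beta>: "\<beta> > 0"
    and cont: "\<And>T. T \<ge> T0 \<Longrightarrow> continuous_on (path_image (parallelogram p q T)) f"
    and int: "\<And>T. T \<ge> T0 \<Longrightarrow> contour_integral (parallelogram p q T) f = c"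
    and bound: "\<And>x s. x \<in> closed_segment p q \<Longrightarrow> \<bar>s\<bar> \<ge> T0 \<Longrightarrow>
      norm (f (diag x s)) \<le> K * norm (quadratic_phase \<beta> (diag x s))"
  shows "((\<lambda>T. contour_integral (diag_path q T) f - contour_integral (diag_path p T) f) \<longlongrightarrow> c) at_top"
proof -
  define X where "X = max \<bar>p\<bar> \<bar>q\<bar>"
  define side where "side s = contour_integral (linepath (diag p s) (diag q s)) f" for s
  define B where "B T = \<bar>K\<bar> * exp (- (2 * pi * \<beta> * (T\<^sup>2 - X * T))) * \<bar>q - p\<bar>" for T
  have side_bound: "norm (side s) \<le> B \<bar>s\<bar>" if s: "\<bar>s\<bar> \<ge> T0" for s
  proof -
    have "norm (f z) \<le> \<bar>K\<bar> * exp (- (2 * pi * \<beta> * (\<bar>s\<bar>\<^sup>2 - X * \<bar>s\<bar>)))"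
      if z: "z \<in> closed_segment (diag p s) (diag q s)" for z
    proof -
      obtain x where x: "x \<in> closed_segment p q" "z = diag x s"
        using closed_segment_diag_horizontal[OF z] .
      have "\<bar>x\<bar> \<le> X"
        using x(1) by (auto simp: closed_segment_eq_real_ivl X_def split: if_splits)
      then have "\<bar>x * s\<bar> \<le> X * \<bar>s\<bar>"
        by (simp add: abs_mult mult_right_mono)
      then have "\<beta> * (\<bar>s\<bar>\<^sup>2 - X * \<bar>s\<bar>) \<le> \<beta> * (s\<^sup>2 + x * s)"
        using \<beta> by (intro mult_left_mono) auto
      then have "norm (quadratic_phase \<beta> z) \<le> exp (- (2 * pi * \<beta> * (\<bar>s\<bar>\<^sup>2 - X * \<bar>s\<bar>)))"
        by (simp add: x(2) norm_quadratic_phase_diag mult.assoc)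
      then have "\<bar>K\<bar> * norm (quadratic_phase \<beta> z)
          \<le> \<bar>K\<bar> * exp (- (2 * pi * \<beta> * (\<bar>s\<bar>\<^sup>2 - X * \<bar>s\<bar>)))"
        by (intro mult_left_mono) auto
      moreover have "norm (f z) \<le> \<bar>K\<bar> * norm (quadratic_phase \<beta> z)"
        using bound[OF x(1) s] x(2)
        by (metis abs_ge_self mult_right_mono norm_ge_zero order_trans)
      ultimately show ?thesis by linarith
    qed
    moreover have "f contour_integrable_on linepath (diag p s) (diag q s)"
    proof (rule contour_integrable_continuous_linepath)
      have "closed_segment (diag p s) (diag q s) \<subseteq> path_image (parallelogram p q \<bar>s\<bar>)"
        unfolding path_image_parallelogram abs_real_def
        by (cases "s < 0") (auto simp: closed_segment_commute)
      then show "continuous_on (closed_segment (diag p s) (diag q s)) f"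
        using cont[OF s] continuous_on_subset by blast
    qed
    ultimately have "norm (side s)
        \<le> \<bar>K\<bar> * exp (- (2 * pi * \<beta> * (\<bar>s\<bar>\<^sup>2 - X * \<bar>s\<bar>))) * norm (diag q s - diag p s)"
      unfolding side_def by (intro contour_integral_bound_linepath) auto
    also have "diag q s - diag p s = of_real (q - p)"
      by (simp add: diag_def)
    finally show ?thesis
      by (simp only: B_def norm_of_real)
  qed
  have "(B \<longlongrightarrow> 0) at_top"
    unfolding B_def using \<beta> by real_asymp
  moreover have "\<forall>\<^sub>F T in at_top. norm (side T) \<le> B T \<and> norm (side (- T)) \<le> B T"
    using eventually_ge_at_top[of "max 0 T0"]
  proof eventually_elim
    case (elim T)
    then show ?case using side_bound[of T] side_bound[of "- T"] by simp
  qed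
  then have "\<forall>\<^sub>F T in at_top. norm (side T) \<le> B T" "\<forall>\<^sub>F T in at_top. norm (side (- T)) \<le> B T"
    by (auto elim: eventually_mono)
  ultimately have "(side \<longlongrightarrow> 0) at_top" "((\<lambda>T. side (- T)) \<longlongrightarrow> 0) at_top"
    by (auto intro: Lim_null_comparison)
  then have "((\<lambda>T. c - side (- T) + side T) \<longlongrightarrow> c - 0 + 0) at_top"
    by (intro tendsto_intros)
  moreover have "\<forall>\<^sub>F T in at_top. c - side (- T) + side T =
      contour_integral (diag_path q T) f - contour_integral (diag_path p T) f"
    using eventually_ge_at_top[of T0]
  proof eventually_elim
    case (elim T)
    show ?case
      using contour_integral_parallelogram[OF cont[OF elim]] int[OF elim]
      by (simp add: side_def)
  qed
  ultimately have "((\<lambda>T. contour_integral (diag_path q T) f - contour_integral (diag_path p T) f)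
      \<longlongrightarrow> c - 0 + 0) at_top"
    by (rule Lim_transform_eventually)
  then show ?thesis by simp
qed

text \<open>The integrand is a multiple of the normal density whose variance is \<open>1 / (4 \<pi> \<beta>)\<close>.\<close>

lemma gaussian_truncated_tendsto:
  assumes "\<beta> > 0"
  shows "((\<lambda>T. integral {- T..T} (\<lambda>s. exp (- (2 * pi * \<beta> * s\<^sup>2)))) \<longlongrightarrow> 1 / sqrt (2 * \<beta>)) at_top"
proof -
  define g where "g s = exp (- (2 * pi * \<beta> * s\<^sup>2))" for s :: real
  define \<sigma> where "\<sigma> = 1 / sqrt (4 * pi * \<beta>)"
  have \<sigma>: "\<sigma> > 0" "\<sigma>\<^sup>2 = 1 / (4 * pi * \<beta>)"
    using assms by (simp_all add: \<sigma>_def power_divide)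
  have "normal_density 0 \<sigma> = (\<lambda>s. sqrt (2 * \<beta>) * g s)"
    using assms by (simp add: fun_eq_iff normal_density_def \<sigma>(2) g_def real_sqrt_divide field_simps)
  then have g: "g = (\<lambda>s. normal_density 0 \<sigma> s / sqrt (2 * \<beta>))"
    using assms by (simp add: fun_eq_iff)
  have intg: "integrable lborel g" and val: "(\<integral>s. g s \<partial>lborel) = 1 / sqrt (2 * \<beta>)"
    using \<sigma>(1) by (simp_all add: g)
  have "((\<lambda>T. \<integral>s. indicator {- T..T} s *\<^sub>R g s \<partial>lborel) \<longlongrightarrow> (\<integral>s. g s \<partial>lborel)) at_top"
  proof (rule integral_dominated_convergence_at_top[where w = g])
    show "AE s in lborel. ((\<lambda>T. indicator {- T..T} s *\<^sub>R g s) \<longlongrightarrow> g s) at_top"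
    proof (rule AE_I2, rule tendsto_eventually)
      fix s :: real
      show "\<forall>\<^sub>F T in at_top. indicator {- T..T} s *\<^sub>R g s = g s"
        using eventually_ge_at_top[of "\<bar>s\<bar>"] by eventually_elim (auto simp: indicator_def)
    qed
    show "\<forall>\<^sub>F T in at_top. AE s in lborel. norm (indicator {- T..T} s *\<^sub>R g s) \<le> g s"
      by (auto simp: indicator_def g_def)
  qed (use intg in \<open>auto simp: borel_measurable_integrable\<close>)
  moreover have "(\<integral>s. indicator {- T..T} s *\<^sub>R g s \<partial>lborel) = integral {- T..T} g" for T
  proof -
    have "set_integrable lborel {- T..T} g"
      unfolding set_integrable_def using intg by (intro integrable_mult_indicator) auto
    then show ?thesis
      by (metis set_borel_integral_eq_integral(2) set_lebesgue_integral_def)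
  qed
  ultimately have "((\<lambda>T. integral {- T..T} g) \<longlongrightarrow> 1 / sqrt (2 * \<beta>)) at_top"
    by (simp add: val)
  then show ?thesis
    by (simp add: g_def[abs_def])
qed

text \<open>Since \<open>(1 + \<i>)\<^sup>2 = 2 \<i>\<close>, the phase is a real Gaussian on the line through the origin.\<close>

lemma quadratic_phase_diag_path_0_tendsto:
  assumes "\<beta> > 0"
  shows "((\<lambda>T. contour_integral (diag_path 0 T) (quadratic_phase \<beta>)) \<longlongrightarrow> (1 + \<i>) / sqrt (2 * \<beta>)) at_top"
proof -
  define g where "g s = exp (- (2 * pi * \<beta> * s\<^sup>2))" for s :: real
  have E: "quadratic_phase \<beta> (diag 0 s) = of_real (g s)" for s
  proof -
    have "(diag 0 s)\<^sup>2 = 2 * \<i> * of_real s ^ 2"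
      by (simp add: diag_def power2_eq_square algebra_simps)
    then show ?thesis
      by (simp add: quadratic_phase_def g_def exp_of_real[symmetric] algebra_simps)
  qed
  have line: "contour_integral (diag_path 0 T) (quadratic_phase \<beta>) = (1 + \<i>) * of_real (integral {- T..T} g)"
    if T: "T > 0" for T
  proof (rule contour_integral_unique)
    have "continuous_on {- T..T} g"
      unfolding g_def by (intro continuous_intros)
    then have "(g has_integral integral {- T..T} g) (cbox (- T) T)"
      by (simp add: integrable_continuous_real integrable_integral)
    from has_integral_affinity'[OF this, of "2 * T" "- T"] T
    have "((\<lambda>u. g (2 * T * u - T)) has_integral (integral {- T..T} g / (2 * T))) {0..1}"
      by (simp add: field_simps)
    then have "((\<lambda>u. of_real (g (2 * T * u - T)) * (2 * of_real T * (1 + \<i>))) has_integral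
        of_real (integral {- T..T} g / (2 * T)) * (2 * of_real T * (1 + \<i>))) {0..1}"
      by (intro has_integral_mult_left has_integral_of_real)
    moreover have "linepath (diag 0 (- T)) (diag 0 T) u = diag 0 (2 * T * u - T)" for u
      by (simp add: linepath_def complex_eq_iff algebra_simps)
    moreover have "diag 0 T - diag 0 (- T) = 2 * of_real T * (1 + \<i>)"
      by (simp add: diag_def)
    moreover have "of_real (integral {- T..T} g / (2 * T)) * (2 * of_real T * (1 + \<i>)) =
        (1 + \<i>) * of_real (integral {- T..T} g)"
      using T by simp
    ultimately show "(quadratic_phase \<beta> has_contour_integral (1 + \<i>) * of_real (integral {- T..T} g))
        (diag_path 0 T)"
      by (simp only: diag_path_def has_contour_integral_linepath E)
  qed
  have "\<forall>\<^sub>F T in at_top. (1 + \<i>) * of_real (integral {- T..T} g) =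
      contour_integral (diag_path 0 T) (quadratic_phase \<beta>)"
    by (rule eventually_mono[OF eventually_gt_at_top[of 0]]) (simp add: line)
  moreover have "((\<lambda>T. (1 + \<i>) * of_real (integral {- T..T} g)) \<longlongrightarrow>
      (1 + \<i>) * of_real (1 / sqrt (2 * \<beta>))) at_top"
    using gaussian_truncated_tendsto[OF assms] unfolding g_def by (intro tendsto_intros)
  ultimately show ?thesis
    using Lim_transform_eventually by fastforce
qed

text \<open>The phase is entire, so by Cauchy's theorem the line may be moved to the origin.\<close>

lemma quadratic_phase_diag_path_tendsto:
  assumes "\<beta> > 0"
  shows "((\<lambda>T. contour_integral (diag_path x T) (quadratic_phase \<beta>)) \<longlongrightarrow> (1 + \<i>) / sqrt (2 * \<beta>)) at_top"
proof -
  have "((\<lambda>T. contour_integral (diag_path x T) (quadratic_phase \<beta>)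
      - contour_integral (diag_path 0 T) (quadratic_phase \<beta>)) \<longlongrightarrow> 0) at_top"
  proof (rule diag_path_difference_tendsto[OF assms, where ?T0.0 = 0 and K = 1])
    show "contour_integral (parallelogram 0 x T) (quadratic_phase \<beta>) = 0" for T
      by (rule contour_integral_unique, rule Cauchy_theorem_convex_simple[of _ UNIV])
        (auto intro: holomorphic_intros)
  qed (auto intro: holomorphic_on_imp_continuous_on holomorphic_intros)
  from tendsto_add[OF this quadratic_phase_diag_path_0_tendsto[OF assms]]
  show ?thesis by simp
qed

section \<open>Gauss sums as sums of residues\<close>

text \<open>
  Each of the four sides is traversed counterclockwise around the point, so it contributes a
  real part strictly between 0 and 1/2. The sum of the four lies strictly between 0 and 2, and
  a winding number is an integer.
\<close>

lemma winding_number_parallelogram: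
  assumes "p < x" "x < q" "T > 0"
  shows "winding_number (parallelogram p q T) (of_real x) = 1"
proof -
  let ?z = "complex_of_real x"
  have z: "?z \<notin> closed_segment (diag p (- T)) (diag q (- T))"
    "?z \<notin> closed_segment (diag q (- T)) (diag q T)"
    "?z \<notin> closed_segment (diag q T) (diag p T)"
    "?z \<notin> closed_segment (diag p T) (diag p (- T))"
    using assms by (auto dest!: closed_segment_diag_slanted Im_closed_segment_diag_horizontal)
  have pos: "0 < Re (winding_number (linepath (diag p (- T)) (diag q (- T))) ?z)"
    "0 < Re (winding_number (linepath (diag q (- T)) (diag q T)) ?z)"
    "0 < Re (winding_number (linepath (diag q T) (diag p T)) ?z)"
    "0 < Re (winding_number (linepath (diag p T) (diag p (- T))) ?z)"
    by (rule winding_number_linepath_pos_lt, use assms in \<open>simp add: algebra_simps\<close>)+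
  have eq: "winding_number (parallelogram p q T) ?z =
      winding_number (linepath (diag p (- T)) (diag q (- T))) ?z +
      (winding_number (linepath (diag q (- T)) (diag q T)) ?z +
      (winding_number (linepath (diag q T) (diag p T)) ?z +
      winding_number (linepath (diag p T) (diag p (- T))) ?z))"
    using z by (simp add: parallelogram_def diag_path_def winding_number_join path_image_join)
  show ?thesis
  proof (rule winding_number_eq_1)
    show "0 < Re (winding_number (parallelogram p q T) ?z)"
      using pos by (simp add: eq)
    show "Re (winding_number (parallelogram p q T) ?z) < 2"
      using z[THEN winding_number_lt_half_linepath] by (simp add: eq)
  qed (use z in \<open>auto simp: path_image_parallelogram\<close>)
qed

lemma exp_2pi_i_eq_1_iff: "exp (2 * pi * \<i> * z) = 1 \<longleftrightarrow> (\<exists>n::int. z = of_int n)"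
  by (subst exp_eq_1) (auto simp: complex_eq_iff mult.commute)

text \<open>Its poles are the integers, and the residue at \<open>n\<close> is the term of the Gauss sum at \<open>n\<close> up to \<open>2 \<pi> \<i>\<close>.\<close>

definition gauss_sum_kernel :: "real \<Rightarrow> complex \<Rightarrow> complex" where
  "gauss_sum_kernel \<beta> z = quadratic_phase \<beta> z / (exp (2 * pi * \<i> * z) - 1)"

text \<open>
  Away from the real axis \<open>exp (2 \<pi> \<i> z)\<close> is either very small or very large, so the denominator
  stays away from 0.
\<close>

lemma norm_gauss_sum_kernel_diag_le:
  assumes "\<bar>s\<bar> \<ge> 1"
  shows "norm (gauss_sum_kernel \<beta> (diag x s)) \<le> 2 * norm (quadratic_phase \<beta> (diag x s))"
proof -
  define w where "w = exp (2 * pi * \<i> * diag x s)"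
  have w: "norm w = exp (- (2 * pi * s))"
    by (simp add: w_def)
  have e: "exp (2 * pi) \<ge> 2"
    using exp_ge_add_one_self[of "2 * pi"] pi_gt3 by linarith
  have "1 / 2 \<le> \<bar>norm w - 1\<bar>"
  proof (cases "s \<ge> 1")
    case True
    have "norm w \<le> exp (- (2 * pi))"
      unfolding w using True by simp
    also have "\<dots> \<le> 1 / 2"
      using e by (simp add: exp_minus field_simps)
    finally show ?thesis by simp
  next
    case False
    then have "2 * pi * 1 \<le> 2 * pi * - s"
      using assms by (intro mult_left_mono) auto
    then have "exp (2 * pi) \<le> norm w"
      unfolding w by simp
    then show ?thesis using e by simp
  qed
  also have "\<dots> \<le> norm (w - 1)"
    using norm_triangle_ineq3[of w 1] by simp
  finally have "1 / 2 \<le> norm (w - 1)" .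
  then have "1 / norm (w - 1) \<le> 1 / (1 / 2)"
    by (intro divide_left_mono) auto
  then have "1 / norm (w - 1) \<le> 2"
    by simp
  then show ?thesis
    using mult_left_mono[of "1 / norm (w - 1)" 2 "norm (quadratic_phase \<beta> (diag x s))"]
    by (simp add: gauss_sum_kernel_def w_def norm_divide mult.commute)
qed

text \<open>The slanted sides cross the real axis at half-integers, so the enclosed poles are \<open>0, \<dots>, c - 1\<close>.\<close>

lemma contour_integral_gauss_sum_kernel:
  assumes T: "T > 0" and c: "c > 0"
  shows "contour_integral (parallelogram (- 1 / 2) (real c - 1 / 2) T) (gauss_sum_kernel \<beta>) =
    (\<Sum>n<c. quadratic_phase \<beta> (of_nat n))"
proof -
  define \<gamma> where "\<gamma> = parallelogram (- 1 / 2) (real c - 1 / 2) T"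
  \<comment> \<open>A convex neighbourhood of the parallelogram that contains no further poles.\<close>
  define U where "U = {z. - 1 < Re z - Im z \<and> Re z - Im z < real c}"
  define pts where "pts = (of_nat :: nat \<Rightarrow> complex) ` {..<c}"
  have U_eq: "U = {z. inner (1 - \<i>) z > - 1} \<inter> {z. inner (1 - \<i>) z < real c}"
    by (auto simp: U_def inner_complex_def)
  have "open U" "convex U"
    unfolding U_eq
    by (intro open_Int open_halfspace_lt open_halfspace_gt convex_Int
        convex_halfspace_lt convex_halfspace_gt)+
  have den: "exp (2 * pi * \<i> * z) \<noteq> 1" if "z \<in> U - pts" for z
  proof
    assume "exp (2 * pi * \<i> * z) = 1"
    then obtain m :: int where "z = of_int m"
      unfolding exp_2pi_i_eq_1_iff by blast
    with that have "z = of_nat (nat m)" "nat m < c"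
      by (auto simp: U_def)
    with that show False by (auto simp: pts_def)
  qed
  have path: "path_image \<gamma> \<subseteq> U - pts"
  proof -
    have "diag (- 1 / 2) t \<in> U" "diag (real c - 1 / 2) t \<in> U" for t
      using c by (auto simp: U_def)
    then have "path_image \<gamma> \<subseteq> U"
      unfolding \<gamma>_def path_image_parallelogram
      by (intro Un_least closed_segment_subset \<open>convex U\<close>)
    moreover have "of_nat n \<notin> path_image \<gamma>" for n
    proof
      assume "of_nat n \<in> path_image \<gamma>"
      then have "T = 0 \<or> 2 * real n = - 1 \<or> 2 * real n = 2 * real c - 1"
        by (auto simp: \<gamma>_def path_image_parallelogram
            dest!: closed_segment_diag_slanted Im_closed_segment_diag_horizontal)
      then have "2 * int n = - 1 \<or> 2 * int n = 2 * int c - 1"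
        using T by linarith
      then show False by presburger
    qed
    ultimately show ?thesis by (auto simp: pts_def)
  qed
  have res: "residue (gauss_sum_kernel \<beta>) (of_nat n) = quadratic_phase \<beta> (of_nat n) / (2 * pi * \<i>)" for n
  proof -
    have "((\<lambda>z. exp (2 * pi * \<i> * z) - 1) has_field_derivative 2 * pi * \<i>) (at (of_nat n))"
      using exp_2pi_i_eq_1_iff[of "of_nat n"]
      by (auto intro!: derivative_eq_intros) (metis of_int_of_nat_eq)
    moreover have "exp (2 * pi * \<i> * of_nat n) = 1"
      using exp_2pi_i_eq_1_iff[of "of_nat n"] by (metis of_int_of_nat_eq)
    ultimately show ?thesis
      unfolding gauss_sum_kernel_def
      by (intro residue_simple_pole_deriv[where s = UNIV and g' = "2 * pi * \<i>"])
        (auto intro!: holomorphic_intros simp: quadratic_phase_def)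
  qed
  have "contour_integral \<gamma> (gauss_sum_kernel \<beta>) =
      2 * pi * \<i> * (\<Sum>z\<in>pts. winding_number \<gamma> z * residue (gauss_sum_kernel \<beta>) z)"
  proof (rule Residue_theorem[OF \<open>open U\<close>])
    show "gauss_sum_kernel \<beta> holomorphic_on U - pts"
      unfolding gauss_sum_kernel_def using den by (intro holomorphic_intros) auto
    show "\<forall>z. z \<notin> U \<longrightarrow> winding_number \<gamma> z = 0"
    proof (intro allI impI)
      fix z assume "z \<notin> U"
      moreover have "path_image \<gamma> \<subseteq> U" using path by blast
      ultimately show "winding_number \<gamma> z = 0"
        using \<open>convex U\<close> by (intro winding_number_zero_outside[of \<gamma> U])
          (simp_all add: \<gamma>_def valid_path_imp_path)
    qed
  qed (use path \<open>convex U\<close> in \<open>auto simp: \<gamma>_def pts_def convex_connected\<close>)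
  also have "\<dots> = 2 * pi * \<i> * (\<Sum>n<c. quadratic_phase \<beta> (of_nat n) / (2 * pi * \<i>))"
  proof -
    have "winding_number \<gamma> (of_nat n) = 1" if "n < c" for n
      using winding_number_parallelogram[of "- 1 / 2" "real n" "real c - 1 / 2" T] that T
      by (simp add: \<gamma>_def)
    then show ?thesis
      by (simp add: pts_def sum.reindex inj_on_def res)
  qed
  finally show ?thesis
    by (simp add: \<gamma>_def sum_divide_distrib[symmetric])
qed

section \<open>Reciprocity of quadratic Gauss sums\<close>

lemma contour_integral_diag_path_translate:
  "contour_integral (diag_path x T) (\<lambda>z. f (z + of_real d)) = contour_integral (diag_path (x + d) T) f"
proof -
  have "linepath (diag x (- T)) (diag x T) u + of_real d = linepath (diag (x + d) (- T)) (diag (x + d) T) u" for u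
    by (simp add: linepath_def complex_eq_iff algebra_simps)
  moreover have "diag (x + d) T - diag (x + d) (- T) = diag x T - diag x (- T)"
    by (simp add: diag_def)
  ultimately show ?thesis
    by (simp add: diag_path_def contour_integral_integral)
qed

text \<open>Completing the square turns the exponential factor into a real translation of the phase.\<close>

lemma quadratic_phase_shift:
  assumes "\<beta> \<noteq> 0"
  shows "quadratic_phase \<beta> z * exp (2 * pi * \<i> * z) ^ k =
    exp (- (pi * \<i> * (of_nat k)\<^sup>2 / of_real \<beta>)) * quadratic_phase \<beta> (z + of_real (real k / \<beta>))"
proof -
  have square: "b * (z + k' / b)\<^sup>2 = b * z\<^sup>2 + 2 * k' * z + k'\<^sup>2 / b" if "b \<noteq> 0" for b k' :: complex
    using that by (simp add: power2_eq_square field_simps)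
  have "\<i> * pi * of_real \<beta> * z\<^sup>2 + of_nat k * (2 * pi * \<i> * z) =
      - (pi * \<i> * (of_nat k)\<^sup>2 / of_real \<beta>) +
      \<i> * pi * (of_real \<beta> * (z + of_nat k / of_real \<beta>)\<^sup>2)"
    using assms by (subst square) (simp_all add: algebra_simps)
  then show ?thesis
    by (simp add: quadratic_phase_def exp_of_nat_mult[symmetric] exp_add[symmetric] mult.assoc)
qed

text \<open>
  Translation by \<open>c\<close> multiplies the phase by \<open>exp (2 \<pi> \<i> z)\<^bsup>a\<^esup>\<close>, because \<open>exp (\<pi> \<i> a c) = 1\<close>, and
  leaves the denominator unchanged. The difference is a geometric sum: the poles cancel.
\<close>

lemma gauss_sum_kernel_translate:
  assumes "even (a * c)" "c > 0" "exp (2 * pi * \<i> * z) \<noteq> 1"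
  shows "gauss_sum_kernel (real a / real c) (z + of_nat c) - gauss_sum_kernel (real a / real c) z =
    (\<Sum>k<a. quadratic_phase (real a / real c) z * exp (2 * pi * \<i> * z) ^ k)"
proof -
  define e where "e = exp (2 * pi * \<i> * z)"
  obtain m where m: "a * c = 2 * m" using assms(1) by blast
  have one: "exp (2 * pi * \<i> * of_nat n) = 1" for n
    using exp_2pi_i_eq_1_iff[of "of_nat n"] by (metis of_int_of_nat_eq)
  have "\<i> * pi * of_real (real a / real c) * (z + of_nat c)\<^sup>2 =
      \<i> * pi * of_real (real a / real c) * z\<^sup>2 + of_nat a * (2 * pi * \<i> * z) + \<i> * pi * of_nat (a * c)"
    using assms(2) by (simp add: field_simps power2_eq_square)
  also have "\<i> * pi * of_nat (a * c) = 2 * pi * \<i> * of_nat m"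
    by (simp add: m)
  finally have "quadratic_phase (real a / real c) (z + of_nat c) = quadratic_phase (real a / real c) z * e ^ a"
    by (simp only: quadratic_phase_def exp_add one e_def exp_of_nat_mult mult_1_right)
  moreover have "exp (2 * pi * \<i> * (z + of_nat c)) = e"
    by (simp only: distrib_left exp_add one e_def mult_1_right)
  ultimately have "gauss_sum_kernel (real a / real c) (z + of_nat c) - gauss_sum_kernel (real a / real c) z =
      quadratic_phase (real a / real c) z * ((e ^ a - 1) / (e - 1))"
    unfolding gauss_sum_kernel_def e_def[symmetric] by (simp add: diff_divide_distrib[symmetric] right_diff_distrib)
  also have "(e ^ a - 1) / (e - 1) = (\<Sum>k<a. e ^ k)"
    using assms(3) by (simp add: geometric_sum e_def)
  finally show ?thesis
    by (simp add: sum_distrib_left e_def)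
qed

text \<open>
  The difference of the integrals of the kernel along two lines at distance \<open>c\<close> is computed twice:
  by residues, which gives the sum on the left, and by translating one line to the other, which
  gives the sum on the right.
\<close>

theorem gauss_sum_reciprocity:
  fixes a c :: nat
  assumes "a > 0" "c > 0" "even (a * c)"
  shows "(\<Sum>n<c. exp (pi * \<i> * of_nat a * (of_nat n)\<^sup>2 / of_nat c)) =
    of_real (sqrt (real c / real a)) * exp (pi * \<i> / 4) *
    (\<Sum>k<a. exp (- (pi * \<i> * of_nat c * (of_nat k)\<^sup>2 / of_nat a)))"
proof -
  define \<beta> where "\<beta> = real a / real c"
  define S where "S = (\<Sum>n<c. quadratic_phase \<beta> (of_nat n))"
  define p where "p = (- 1 / 2 :: real)"
  define q where "q = real c - 1 / 2"
  define w where "w k = exp (- (pi * \<i> * (of_nat k)\<^sup>2 / of_real \<beta>))" for k :: nat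
  have \<beta>: "\<beta> > 0" using assms by (simp add: \<beta>_def)
  have den: "exp (2 * pi * \<i> * z) \<noteq> 1" if "Re z - Im z \<in> {p, q} \<or> Im z \<noteq> 0" for z
  proof
    assume "exp (2 * pi * \<i> * z) = 1"
    then obtain m :: int where m: "z = of_int m"
      unfolding exp_2pi_i_eq_1_iff by blast
    with that have "2 * real_of_int m = - 1 \<or> 2 * real_of_int m = 2 * real c - 1"
      by (auto simp: p_def q_def)
    then have "2 * m = - 1 \<or> 2 * m = 2 * int c - 1"
      by linarith
    then show False by presburger
  qed
  have hol: "gauss_sum_kernel \<beta> holomorphic_on A" if "\<And>z. z \<in> A \<Longrightarrow> exp (2 * pi * \<i> * z) \<noteq> 1" for A
    unfolding gauss_sum_kernel_def using that by (intro holomorphic_intros) auto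
  have cont_diag: "continuous_on (closed_segment (diag x s) (diag x t)) (gauss_sum_kernel \<beta>)"
    if "x \<in> {p, q}" for x s t
    using that closed_segment_diag_slanted by (intro holomorphic_on_imp_continuous_on hol den) blast
  have "((\<lambda>T. contour_integral (diag_path q T) (gauss_sum_kernel \<beta>)
      - contour_integral (diag_path p T) (gauss_sum_kernel \<beta>)) \<longlongrightarrow> S) at_top"
  proof (rule diag_path_difference_tendsto[OF \<beta>, where ?T0.0 = 1 and K = 2])
    fix T :: real assume T: "T \<ge> 1"
    show "contour_integral (parallelogram p q T) (gauss_sum_kernel \<beta>) = S"
      unfolding p_def q_def S_def using T assms(2) by (intro contour_integral_gauss_sum_kernel) auto
    have "Im z \<noteq> 0" if "z \<in> closed_segment (diag x s) (diag y s)" "\<bar>s\<bar> = T" for x y z s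
      using Im_closed_segment_diag_horizontal[OF that(1)] T that(2) by force
    then have "continuous_on (closed_segment (diag x s) (diag y s)) (gauss_sum_kernel \<beta>)" if "\<bar>s\<bar> = T" for x y s
      using that by (intro holomorphic_on_imp_continuous_on hol den) auto
    then show "continuous_on (path_image (parallelogram p q T)) (gauss_sum_kernel \<beta>)"
      unfolding path_image_parallelogram using T
      by (intro continuous_on_closed_Un cont_diag closed_Un closed_segment) auto
  qed (rule norm_gauss_sum_kernel_diag_le)
  moreover have "contour_integral (diag_path q T) (gauss_sum_kernel \<beta>)
      - contour_integral (diag_path p T) (gauss_sum_kernel \<beta>) =
      (\<Sum>k<a. w k * contour_integral (diag_path (p + real k / \<beta>) T) (quadratic_phase \<beta>))" for T
  proof -
    define E where "E k z = w k * quadratic_phase \<beta> (z + of_real (real k / \<beta>))" for k z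
    have q: "q = p + real c" by (simp add: p_def q_def)
    have "contour_integral (diag_path q T) (gauss_sum_kernel \<beta>)
        = contour_integral (diag_path p T) (\<lambda>z. gauss_sum_kernel \<beta> (z + of_nat c))"
      using contour_integral_diag_path_translate[of p T "gauss_sum_kernel \<beta>" "real c"]
      by (simp add: q)
    moreover have "(\<lambda>z. gauss_sum_kernel \<beta> (z + of_nat c)) contour_integrable_on diag_path p T"
      unfolding diag_path_def
    proof (rule contour_integrable_continuous_linepath, rule continuous_on_compose2[where g = "gauss_sum_kernel \<beta>"])
      show "continuous_on {z. Re z - Im z = q} (gauss_sum_kernel \<beta>)"
        by (intro holomorphic_on_imp_continuous_on hol den) auto
      show "(\<lambda>z. z + of_nat c) ` closed_segment (diag p (- T)) (diag p T) \<subseteq> {z. Re z - Im z = q}"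
        using closed_segment_diag_slanted by (force simp: q)
    qed (intro continuous_intros)
    moreover have "gauss_sum_kernel \<beta> contour_integrable_on diag_path p T"
      unfolding diag_path_def by (intro contour_integrable_continuous_linepath cont_diag) auto
    ultimately have "contour_integral (diag_path q T) (gauss_sum_kernel \<beta>)
      - contour_integral (diag_path p T) (gauss_sum_kernel \<beta>) =
      contour_integral (diag_path p T) (\<lambda>z. gauss_sum_kernel \<beta> (z + of_nat c) - gauss_sum_kernel \<beta> z)"
      by (simp add: contour_integral_diff)
    also have "\<dots> = contour_integral (diag_path p T) (\<lambda>z. \<Sum>k<a. E k z)"
    proof (rule contour_integral_cong[OF refl])
      fix z assume "z \<in> path_image (diag_path p T)"
      then have "exp (2 * pi * \<i> * z) \<noteq> 1"
        using closed_segment_diag_slanted by (intro den) (auto simp: diag_path_def)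
      then have "gauss_sum_kernel \<beta> (z + of_nat c) - gauss_sum_kernel \<beta> z =
          (\<Sum>k<a. quadratic_phase \<beta> z * exp (2 * pi * \<i> * z) ^ k)"
        unfolding \<beta>_def by (rule gauss_sum_kernel_translate[OF assms(3,2)])
      also have "\<dots> = (\<Sum>k<a. E k z)"
        unfolding E_def w_def using \<beta> by (intro sum.cong refl quadratic_phase_shift) simp
      finally show "gauss_sum_kernel \<beta> (z + of_nat c) - gauss_sum_kernel \<beta> z = (\<Sum>k<a. E k z)" .
    qed
    also have "\<dots> = (\<Sum>k<a. contour_integral (diag_path p T) (E k))"
      unfolding diag_path_def E_def quadratic_phase_def
      by (intro contour_integral_sum contour_integrable_continuous_linepath continuous_intros) auto
    also have "\<dots> = (\<Sum>k<a. w k * contour_integral (diag_path (p + real k / \<beta>) T) (quadratic_phase \<beta>))"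
    proof (rule sum.cong[OF refl])
      fix k
      have "(\<lambda>z. quadratic_phase \<beta> (z + of_real (real k / \<beta>))) contour_integrable_on diag_path p T"
        unfolding diag_path_def quadratic_phase_def
        by (intro contour_integrable_continuous_linepath continuous_intros)
      then show "contour_integral (diag_path p T) (E k) =
          w k * contour_integral (diag_path (p + real k / \<beta>) T) (quadratic_phase \<beta>)"
        unfolding E_def
        by (simp only: contour_integral_lmul contour_integral_diag_path_translate)
    qed
    finally show ?thesis .
  qed
  moreover have "((\<lambda>T. \<Sum>k<a. w k * contour_integral (diag_path (p + real k / \<beta>) T) (quadratic_phase \<beta>))
      \<longlongrightarrow> (\<Sum>k<a. w k * ((1 + \<i>) / sqrt (2 * \<beta>)))) at_top"
    by (intro tendsto_sum tendsto_mult_left quadratic_phase_diag_path_tendsto \<beta>)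
  ultimately have "S = (\<Sum>k<a. w k * ((1 + \<i>) / sqrt (2 * \<beta>)))"
    using tendsto_unique[OF trivial_limit_at_top_linorder] by (simp only:) blast
  moreover have "(1 + \<i>) / sqrt (2 * \<beta>) = of_real (sqrt (real c / real a)) * exp (pi * \<i> / 4)"
  proof -
    have "exp (pi * \<i> / 4) = cis (pi / 4)"
      by (simp add: cis_conv_exp mult.commute)
    also have "\<dots> = (1 + \<i>) / sqrt 2"
      by (simp add: complex_eq_iff cos_45 sin_45 field_simps)
    finally have e: "exp (pi * \<i> / 4) = (1 + \<i>) / sqrt 2" .
    have "sqrt (2 * \<beta>) = sqrt 2 * sqrt (real a) / sqrt (real c)"
      by (simp add: \<beta>_def real_sqrt_mult real_sqrt_divide)
    then show ?thesis
      unfolding e by (simp add: real_sqrt_divide mult.commute)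
  qed
  moreover have "w k = exp (- (pi * \<i> * of_nat c * (of_nat k)\<^sup>2 / of_nat a))" for k
    by (simp add: w_def \<beta>_def field_simps)
  moreover have "quadratic_phase \<beta> (of_nat n) = exp (pi * \<i> * of_nat a * (of_nat n)\<^sup>2 / of_nat c)" for n
    by (simp add: quadratic_phase_def \<beta>_def field_simps)
  ultimately show ?thesis
    by (simp only: S_def sum_distrib_left mult.commute)
qed

text \<open>The case of a negative \<open>b\<close> is the reciprocity law itself; that of a positive \<open>b\<close> is its complex conjugate.\<close>

lemma signed_gauss_sum_reciprocity:
  fixes b :: int and r :: nat
  assumes "b \<noteq> 0" "r > 0"
  shows "(\<Sum>n<2 * r. exp (- (pi * \<i> * of_int b * (of_nat n)\<^sup>2) / (2 * of_nat r))) =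
    of_real (sqrt (2 * real r / real_of_int \<bar>b\<bar>)) * exp (- (pi * \<i> * of_int (sgn b)) / 4) *
    (\<Sum>n<nat \<bar>b\<bar>. exp (2 * pi * \<i> * of_nat r * (of_nat n)\<^sup>2 / of_int b))"
proof -
  define a where "a = nat \<bar>b\<bar>"
  have a: "a > 0" "\<bar>real_of_int b\<bar> = real a" using assms by (simp_all add: a_def)
  have R: "(\<Sum>n<2 * r. exp (pi * \<i> * of_nat a * (of_nat n)\<^sup>2 / of_nat (2 * r))) =
    of_real (sqrt (real (2 * r) / real a)) * exp (pi * \<i> / 4) *
    (\<Sum>k<a. exp (- (pi * \<i> * of_nat (2 * r) * (of_nat k)\<^sup>2 / of_nat a)))"
    using a(1) assms(2) by (intro gauss_sum_reciprocity) auto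
  show ?thesis
  proof (cases "b > 0")
    case True
    then have b: "of_int b = (of_nat a :: complex)" "sgn b = 1"
      by (simp_all add: a_def)
    show ?thesis
      using arg_cong[OF R, of cnj] by (simp add: exp_cnj b a(2) a_def[symmetric] mult_ac)
  next
    case False
    then have b: "of_int b = - (of_nat a :: complex)" "sgn b = - 1"
      using assms by (simp_all add: a_def sgn_if)
    show ?thesis
      using R by (simp add: b a(2) a_def[symmetric] mult_ac)
  qed
qed

section \<open>Half of a complete Gauss sum\<close>

lemma sum_symmetric_lessThan_double:
  fixes f :: "nat \<Rightarrow> 'a :: comm_semiring_1"
  assumes "r > 0" and sym: "\<And>n. n \<le> r \<Longrightarrow> f (2 * r - n) = f n"
  shows "(\<Sum>n<2 * r. f n) = f 0 + f r + 2 * (\<Sum>n=1..<r. f n)"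
proof -
  have "{..<2 * r} = insert 0 (insert r ({1..<r} \<union> {Suc r..<2 * r}))"
    using assms(1) by auto
  moreover have "(\<Sum>n=Suc r..<2 * r. f n) = (\<Sum>n=1..<r. f n)"
    by (rule sum.reindex_bij_witness[of _ "\<lambda>n. 2 * r - n" "\<lambda>n. 2 * r - n"])
      (use sym in \<open>auto simp: sym[symmetric]\<close>)
  ultimately show ?thesis
    using assms(1) by (simp add: sum.union_disjoint ivl_disj_int algebra_simps mult_2)
qed

lemma quadratic_exponential_reflect:
  fixes b :: int and r n :: nat
  assumes "r > 0" "n \<le> 2 * r"
  shows "exp (- (pi * \<i> * of_int b * (of_nat (2 * r - n))\<^sup>2) / (2 * of_nat r)) =
    exp (- (pi * \<i> * of_int b * (of_nat n)\<^sup>2) / (2 * of_nat r))"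
proof -
  have "- (pi * \<i> * of_int b * (of_nat (2 * r - n))\<^sup>2) / (2 * of_nat r) =
      - (pi * \<i> * of_int b * (of_nat n)\<^sup>2) / (2 * of_nat r)
      + 2 * pi * \<i> * of_int (b * (int n - int r))"
    using assms by (simp add: of_nat_diff field_simps power2_eq_square)
  moreover have "exp (2 * pi * \<i> * of_int (b * (int n - int r))) = 1"
    using exp_2pi_i_eq_1_iff by blast
  ultimately show ?thesis
    by (simp only: exp_add mult_1_right)
qed

lemma half_gauss_sum:
  fixes b :: int and r :: nat
  assumes "b \<noteq> 0" "r > 0"
  shows "(\<Sum>n=1..<r. exp (- (pi * \<i> * of_int b * (of_nat n)\<^sup>2) / (2 * of_nat r))) =
    of_real (sqrt (real r / (2 * real_of_int \<bar>b\<bar>))) * exp (- (pi * \<i> * of_int (sgn b)) / 4) *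
      (\<Sum>n<nat \<bar>b\<bar>. exp (2 * pi * \<i> * of_nat r * (of_nat n)\<^sup>2 / of_int b))
    - 1 / 2 - exp (- (pi * \<i> * of_nat r * of_int b) / 2) / 2"
proof -
  define f where "f n = exp (- (pi * \<i> * of_int b * (of_nat n)\<^sup>2) / (2 * of_nat r))" for n :: nat
  define u where "u = complex_of_real (sqrt (real r / (2 * real_of_int \<bar>b\<bar>)))"
  define v where "v = exp (- (pi * \<i> * of_int (sgn b)) / 4)"
  define G where "G = (\<Sum>n<nat \<bar>b\<bar>. exp (2 * pi * \<i> * of_nat r * (of_nat n)\<^sup>2 / of_int b))"
  have "sqrt (2 * real r / real_of_int \<bar>b\<bar>) = 2 * sqrt (real r / (2 * real_of_int \<bar>b\<bar>))"
    by (rule real_sqrt_unique) (simp_all add: power_mult_distrib real_sqrt_pow2)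
  then have "(\<Sum>n<2 * r. f n) = 2 * u * v * G"
    unfolding f_def u_def v_def G_def signed_gauss_sum_reciprocity[OF assms] by simp
  moreover have "(\<Sum>n<2 * r. f n) = f 0 + f r + 2 * (\<Sum>n=1..<r. f n)"
    using assms(2) unfolding f_def
    by (intro sum_symmetric_lessThan_double quadratic_exponential_reflect) auto
  moreover have "f 0 = 1"
    by (simp add: f_def)
  ultimately have "(\<Sum>n=1..<r. f n) = u * v * G - 1 / 2 - f r / 2"
    by (simp add: field_simps)
  moreover have "f r = exp (- (pi * \<i> * of_nat r * of_int b) / 2)"
    using assms(2) by (simp add: f_def power2_eq_square field_simps)
  ultimately show ?thesis
    by (simp only: f_def u_def v_def G_def)
qed

section \<open>The trace of a power of the twist\<close>

lemma mat_inverse_eqI: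
  fixes A B :: "'a :: field mat"
  assumes A: "A \<in> carrier_mat n n" and B: "B \<in> carrier_mat n n"
    and AB: "A * B = 1\<^sub>m n" and BA: "B * A = 1\<^sub>m n"
  shows "the (mat_inverse A) = B"
proof (cases "mat_inverse A")
  case None
  have "A \<in> Units (ring_mat TYPE('a) n ())"
    using assms by (auto simp: Units_def ring_mat_def)
  with mat_inverse(1)[OF A None, where b = "()"] show ?thesis by blast
next
  case (Some C)
  then have C: "A * C = 1\<^sub>m n" "C \<in> carrier_mat n n"
    using mat_inverse(2)[OF A Some] by auto
  have "C = B * A * C"
    using C(2) by (simp add: BA)
  also have "\<dots> = B"
    using assoc_mult_mat[OF B A C(2)] C(1) B by simp
  finally show ?thesis by (simp add: Some)
qed

lemma gen_op_Twist: "gen_op k Twist = mat_diag (k + 1) (\<lambda>i. skein_a k ^ (i\<^sup>2 + 2 * i))"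
  by (auto simp: mat_diag_def)

lemma mat_inverse_gen_op_Twist:
  "the (mat_inverse (gen_op k Twist)) = mat_diag (k + 1) (\<lambda>i. inverse (skein_a k ^ (i\<^sup>2 + 2 * i)))"
  unfolding gen_op_Twist
  by (rule mat_inverse_eqI) (simp_all add: mat_diag_diag skein_a_def)

text \<open>Powers of the twist stay diagonal, also when its letters are inverted.\<close>

lemma quantum_rep_replicate_Twist:
  "quantum_rep k (replicate m (Twist, inverted)) = mat_diag (k + 1) (\<lambda>i.
    (if inverted then inverse (skein_a k ^ (i\<^sup>2 + 2 * i)) else skein_a k ^ (i\<^sup>2 + 2 * i)) ^ m)"
proof (induction m)
  case (Suc m)
  then show ?case
    by (cases inverted)
      (simp_all add: mat_inverse_gen_op_Twist mat_diag_diag del: gen_op.simps,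
        simp add: gen_op_Twist mat_diag_diag del: gen_op.simps)
qed (simp add: mat_diag_one)

lemma mat_trace_mat_diag: "mat_trace (mat_diag n d) = (\<Sum>i<n. d i)"
  by (simp add: mat_trace_def mat_diag_def)

lemma Z_SU2_M_eq_sum:
  "Z_SU2 k (M b) =
    (\<Sum>i<k + 1. exp (- (pi * \<i> * of_int b * of_nat (i\<^sup>2 + 2 * i)) / (2 * of_nat (k + 2))))"
proof -
  define r where "r = k + 2"
  have a: "skein_a k = exp (- (pi * \<i>) / (2 * of_nat r))"
    unfolding skein_a_def r_def[symmetric] by (simp add: mult.commute)
  have pow: "skein_a k ^ e = exp (- (pi * \<i> * of_nat e) / (2 * of_nat r))" for e
    by (simp add: a exp_of_nat_mult[symmetric] mult_ac)
  have entry: "(if b < 0 then inverse (skein_a k ^ e) else skein_a k ^ e) ^ nat \<bar>b\<bar> =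
      exp (- (pi * \<i> * of_int b * of_nat e) / (2 * of_nat r))" for e
  proof (cases "b < 0")
    case True
    then have "of_nat (nat \<bar>b\<bar>) = (- of_int b :: complex)" by simp
    then show ?thesis
      using True by (simp add: pow exp_minus[symmetric] exp_of_nat_mult[symmetric] mult_ac)
  next
    case False
    then have "of_nat (nat \<bar>b\<bar>) = (of_int b :: complex)" by simp
    then show ?thesis
      using False by (simp add: pow exp_of_nat_mult[symmetric] mult_ac)
  qed
  have "Z_SU2 k (M b) =
      (\<Sum>i<k + 1. (if b < 0 then inverse (skein_a k ^ (i\<^sup>2 + 2 * i)) else skein_a k ^ (i\<^sup>2 + 2 * i)) ^ nat \<bar>b\<bar>)"
    by (simp only: Z_SU2_def M_def framed_mapping_torus_def twist_power_def case_prod_conv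
        quantum_rep_replicate_Twist mat_trace_mat_diag)
  then show ?thesis
    by (simp only: entry r_def)
qed

lemma Z_SU2_M_tilde: "Z_SU2 k (M_tilde b) = Z_SU2 k (M b)"
  by (simp add: Z_SU2_def M_def M_tilde_def framed_mapping_torus_def twist_power_def
      quantum_rep_replicate_Twist left_mult_one_mat[OF mat_diag_dim])

theorem corollary3p1p5:
  fixes b :: int and k r :: nat
  assumes "b \<noteq> 0" and "r = k + 2"
  shows "Z_SU2 k (M b) = Z_SU2 k (M_tilde b) \<and>
    Z_SU2 k (M_tilde b) =
      exp (pi * \<i> * of_int b / (2 * of_nat r)) *
      (complex_of_real (sqrt (real r / (2 * real_of_int \<bar>b\<bar>))) *
         exp (- (pi * \<i> * of_int (sgn b)) / 4) *
         (\<Sum>n<nat \<bar>b\<bar>. exp (2 * pi * \<i> * of_nat r * (of_nat n)\<^sup>2 / of_int b))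
       - 1 / 2
       - exp (- (pi * \<i> * of_nat r * of_int b) / 2) / 2)"
proof -
  have r: "r > 0" using assms(2) by simp
  \<comment> \<open>\<open>i\<^sup>2 + 2 i = (i + 1)\<^sup>2 - 1\<close>: the \<open>- 1\<close> is the source of the prefactor.\<close>
  have square: "exp (- (pi * \<i> * of_int b * of_nat (i\<^sup>2 + 2 * i)) / (2 * of_nat r)) =
      exp (pi * \<i> * of_int b / (2 * of_nat r)) *
      exp (- (pi * \<i> * of_int b * (of_nat (Suc i))\<^sup>2) / (2 * of_nat r))" for i
  proof -
    have "of_nat (i\<^sup>2 + 2 * i) = (of_nat (Suc i))\<^sup>2 - (1 :: complex)"
      by (simp add: power2_eq_square algebra_simps)
    moreover have "- (x * (y - 1)) / d = x / d + - (x * y) / d" for x y d :: complex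
      by (simp add: algebra_simps diff_divide_distrib)
    ultimately have "- (pi * \<i> * of_int b * of_nat (i\<^sup>2 + 2 * i)) / (2 * of_nat r) =
        pi * \<i> * of_int b / (2 * of_nat r) +
        - (pi * \<i> * of_int b * (of_nat (Suc i))\<^sup>2) / (2 * of_nat r)"
      by (simp only:)
    then show ?thesis
      by (simp only: exp_add)
  qed
  have "Z_SU2 k (M b) = (\<Sum>i<k + 1. exp (pi * \<i> * of_int b / (2 * of_nat r)) *
      exp (- (pi * \<i> * of_int b * (of_nat (Suc i))\<^sup>2) / (2 * of_nat r)))"
    unfolding Z_SU2_M_eq_sum assms(2)[symmetric] square ..
  also have "\<dots> = exp (pi * \<i> * of_int b / (2 * of_nat r)) *
      (\<Sum>n=1..<r. exp (- (pi * \<i> * of_int b * (of_nat n)\<^sup>2) / (2 * of_nat r)))"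
    unfolding sum_distrib_left[symmetric]
    by (rule arg_cong[where f = "(*) _"], rule sum.reindex_bij_witness[of _ "\<lambda>n. n - 1" Suc])
      (auto simp: assms(2))
  finally have "Z_SU2 k (M b) = \<dots>" .
  then show ?thesis
    unfolding Z_SU2_M_tilde half_gauss_sum[OF assms(1) r] by (rule conjI[OF refl])
qed

end
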